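(* Let $\Delta=p_1\cdots p_n$ be a product of distinct primes $p_i\equiv1\pmod4$. If $a,b$ are positive integers with $ab=\Delta$ and $ar^2-bs^2=4$ has an integral solution, then: (1) $\big(\frac aq\big)=1$ for all primes $q\mid b$; (2) $\big(\frac bp\big)=1$ for all primes $p\mid a$; (3) $\big(\frac ba\big)_4=+1$.
   Context: $\big(\frac{\cdot}{p}\big)$ is the Legendre symbol. For an odd prime $p$ and an integer $b$ with $\big(\frac bp\big)=1$, the quartic symbol $\big(\frac bp\big)_4$ is $+1$ if $b$ is a fourth power modulo $p$ and $-1$ otherwise; for a product $a$ of distinct odd primes each satisfying this condition, $\big(\frac ba\big)_4=\prod_{p\mid a}\big(\frac bp\big)_4$ (and $\big(\frac b1\big)_4=1$). *)

theory Defs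
  imports "HOL-Number_Theory.Number_Theory"
begin

(* The quartic symbol (b/p)_4 is only meaningful for an odd prime p with (b/p) = 1.
   Where (b/p) is not 1 it takes the junk value 0, so it is never +1 or -1 there. *)
definition quartic_symbol_prime :: "int \<Rightarrow> int \<Rightarrow> int"
  where "quartic_symbol_prime b p =
    (if Legendre b p \<noteq> 1 then 0
     else if \<exists>x. [x ^ 4 = b] (mod p) then 1
     else -1)"

(* Only meaningful for a product a of distinct odd primes p (possibly a = 1) with (b/p) = 1. *)
definition quartic_symbol :: "int \<Rightarrow> int \<Rightarrow> int"
  where "quartic_symbol b a = (\<Prod>p\<in>prime_factors a. quartic_symbol_prime b p)"

lemma quartic_symbol_1: "quartic_symbol b 1 = 1"
  by (simp add: quartic_symbol_def)

end

theory Submission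
  imports Defs "HOL-Computational_Algebra.Squarefree"
begin

text \<open>Reducing the equation modulo the primes dividing \<open>b\<close> and \<open>a\<close> gives (1) and (2).
For (3), let \<open>p\<close> be a prime dividing \<open>a\<close> and \<open>i\<close> a square root of \<open>-1\<close> modulo \<open>p\<close>. Then
\<open>b s\<^sup>2\<close> is congruent to \<open>-4 = (1 + i)\<^sup>4\<close>, so the quartic symbol of \<open>b\<close> at \<open>p\<close> is the
Legendre symbol of \<open>s\<close> at \<open>p\<close>, and it remains to show that the Jacobi symbol \<open>(s/a)\<close> is 1.
Every odd prime \<open>l\<close> dividing \<open>s\<close> satisfies \<open>(a/l) = 1\<close> because \<open>a r\<^sup>2\<close> is congruent to 4
modulo \<open>l\<close>, and so \<open>(l/a) = 1\<close> by quadratic reciprocity. The powers of 2 in \<open>s\<close> contribute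
nothing: if \<open>s\<close> is even, so is \<open>r\<close>, and the equation divided by 4, read modulo 4 and
modulo 8, shows that either 2 divides \<open>s\<close> to an even power, or \<open>8\<close> divides \<open>s\<close> and \<open>a\<close> is 1 modulo 8, whence \<open>(2/a) = 1\<close>.\<close>

section \<open>The Legendre symbol\<close>

lemma euler_criterion_int:
  fixes p :: int
  assumes "prime p" "2 < p"
  shows "[Legendre a p = a ^ nat ((p - 1) div 2)] (mod p)"
proof -
  have "prime (nat p)" "2 < nat p"
    using assms by auto
  from euler_criterion[OF this, of a] show ?thesis
    using assms by (simp add: nat_div_distrib nat_diff_distrib)
qed

lemma Legendre_cases: "Legendre a p \<in> {-1, 0, 1}"
  by (auto simp: Legendre_def)

lemma Legendre_eq_1_iff: "Legendre a p = 1 \<longleftrightarrow> \<not> p dvd a \<and> QuadRes p a"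
  by (auto simp: Legendre_def cong_0_iff)

lemma Legendre_cases_not_dvd: "\<not> p dvd a \<Longrightarrow> Legendre a p = 1 \<or> Legendre a p = -1"
  by (auto simp: Legendre_def cong_0_iff)

text \<open>Two such values differ by at most 2, which is less than \<open>p\<close>. This turns the
  congruences of Euler's criterion into equalities of symbols.\<close>

lemma cong_imp_eq_signs:
  fixes x y p :: int
  assumes "[x = y] (mod p)" "2 < p" "x \<in> {-1, 0, 1}" "y \<in> {-1, 0, 1}"
  shows "x = y"
proof (rule ccontr)
  assume "x \<noteq> y"
  moreover have "p dvd x - y"
    using assms(1) by (simp add: cong_iff_dvd_diff)
  ultimately have "\<bar>p\<bar> \<le> \<bar>x - y\<bar>"
    by (intro dvd_imp_le_int) auto
  with assms show False by auto
qed

lemma Legendre_mult: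
  fixes p :: int
  assumes "prime p" "2 < p"
  shows "Legendre (a * b) p = Legendre a p * Legendre b p"
proof (rule cong_imp_eq_signs[OF _ assms(2)])
  let ?k = "nat ((p - 1) div 2)"
  have "[Legendre (a * b) p = a ^ ?k * b ^ ?k] (mod p)"
    using euler_criterion_int[OF assms, of "a * b"] by (simp add: power_mult_distrib)
  moreover have "[Legendre a p * Legendre b p = a ^ ?k * b ^ ?k] (mod p)"
    by (intro cong_mult euler_criterion_int assms)
  ultimately show "[Legendre (a * b) p = Legendre a p * Legendre b p] (mod p)"
    by (meson cong_sym cong_trans)
  show "Legendre a p * Legendre b p \<in> {-1, 0, 1}"
    using Legendre_cases[of a p] Legendre_cases[of b p] by auto
qed (rule Legendre_cases)

lemma Legendre_1:
  fixes p :: int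
  assumes "prime p"
  shows "Legendre 1 p = 1"
  using assms not_prime_unit[of p] unfolding Legendre_eq_1_iff QuadRes_def
  by (auto intro!: exI[of _ 1])

lemma Legendre_power:
  fixes p :: int
  assumes "prime p" "2 < p"
  shows "Legendre (a ^ k) p = Legendre a p ^ k"
  by (induction k) (simp_all add: Legendre_1 Legendre_mult assms)

lemma Legendre_prod:
  fixes p :: int
  assumes "prime p" "2 < p"
  shows "Legendre (\<Prod>x\<in>A. f x) p = (\<Prod>x\<in>A. Legendre (f x) p)"
  by (induction A rule: infinite_finite_induct) (simp_all add: Legendre_1 Legendre_mult assms)

text \<open>The product is a nonzero square modulo \<open>p\<close>, and by multiplicativity its
  factor \<open>x\<^sup>2\<close> contributes only 1 to the symbol.\<close>

lemma Legendre_cong_square: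
  fixes p :: int
  assumes "prime p" "2 < p" "\<not> p dvd y" "[a * x\<^sup>2 = y\<^sup>2] (mod p)"
  shows "Legendre a p = 1"
proof -
  have nd: "\<not> p dvd a * x\<^sup>2"
    using assms cong_dvd_iff[OF assms(4)] by (simp add: prime_dvd_power_iff)
  then have "\<not> p dvd a" "\<not> p dvd x" by (auto simp: power2_eq_square)
  have "QuadRes p (a * x\<^sup>2)"
    unfolding QuadRes_def using assms(4) cong_sym by blast
  with nd have "Legendre (a * x\<^sup>2) p = 1"
    by (simp add: Legendre_eq_1_iff)
  then have "Legendre a p * Legendre x p ^ 2 = 1"
    using assms by (simp add: Legendre_mult power2_eq_square)
  with Legendre_cases_not_dvd[OF \<open>\<not> p dvd x\<close>] show ?thesis
    by auto
qed

lemma prime_cong_1_mod_4_gt_2: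
  fixes p :: int
  assumes "prime p" "[p = 1] (mod 4)"
  shows "2 < p"
proof -
  have "p \<noteq> 2" using assms(2) by (auto simp: cong_def)
  with prime_ge_2_int[OF assms(1)] show ?thesis by simp
qed

text \<open>The exponent \<open>(p - 1) div 2\<close> in Euler's criterion is even.\<close>

lemma Legendre_minus_1:
  fixes p :: int
  assumes "prime p" "[p = 1] (mod 4)"
  shows "Legendre (-1) p = 1"
proof -
  have p2: "2 < p" using prime_cong_1_mod_4_gt_2 assms by blast
  obtain k where "p = 4 * k + 1"
    using assms(2) by (metis cong_iff_dvd_diff dvd_def diff_eq_eq)
  then have "nat ((p - 1) div 2) = 2 * nat k"
    using p2 by simp
  then have "[Legendre (-1) p = 1] (mod p)"
    using euler_criterion_int[OF assms(1) p2, of "-1"] by simp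
  then show ?thesis
    using p2 Legendre_cases by (intro cong_imp_eq_signs) auto
qed

text \<open>Negation turns -4 into the square \<open>2\<^sup>2\<close>, and -1 is itself a square
  modulo \<open>p\<close>.\<close>

lemma Legendre_cong_minus_4:
  fixes p b s :: int
  assumes p: "prime p" "[p = 1] (mod 4)" and bs: "[b * s\<^sup>2 = -4] (mod p)"
  shows "Legendre b p = 1"
proof -
  have p2: "2 < p" using prime_cong_1_mod_4_gt_2 p by blast
  then have "\<not> p dvd 2" by (auto dest: zdvd_imp_le)
  moreover have "[(b * s\<^sup>2) * -1 = -4 * -1] (mod p)"
    by (rule cong_mult[OF bs cong_refl])
  then have "[(- b) * s\<^sup>2 = 2\<^sup>2] (mod p)"
    by simp
  ultimately have "Legendre (- b) p = 1"
    by (rule Legendre_cong_square[OF p(1) p2])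
  then show ?thesis
    using Legendre_mult[OF p(1) p2, of "-1" b] Legendre_minus_1[OF p] by simp
qed

lemma sqrt_minus_1_mod:
  fixes p :: int
  assumes "prime p" "[p = 1] (mod 4)"
  obtains i where "[i\<^sup>2 = -1] (mod p)"
  using Legendre_minus_1[OF assms] by (auto simp: Legendre_eq_1_iff QuadRes_def)

text \<open>Since \<open>2 i = (1 + i)\<^sup>2\<close>, the symbols of 2 and \<open>i\<close> agree, and the latter is
\<open>(-1) ^ ((p - 1) div 4)\<close> by Euler's criterion.\<close>

lemma Legendre_2:
  fixes p :: int
  assumes "prime p" "[p = 1] (mod 4)"
  shows "Legendre 2 p = (if p mod 8 = 1 then 1 else -1)"
proof -
  have p2: "2 < p" using prime_cong_1_mod_4_gt_2 assms by blast
  obtain i where i: "[i\<^sup>2 = -1] (mod p)"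
    using sqrt_minus_1_mod[OF assms] .
  obtain k where k: "p = 4 * k + 1"
    using assms(2) by (metis cong_iff_dvd_diff dvd_def diff_eq_eq)
  have ndi: "\<not> p dvd i"
    using cong_dvd_iff[OF i] assms(1) not_prime_unit[of p] by (auto simp: power2_eq_square)
  have nd2: "\<not> p dvd 2"
    using p2 by (auto dest: zdvd_imp_le)
  have "[(1 + i)\<^sup>2 = 2 * i] (mod p)"
    using cong_add[OF i cong_refl[of "1 + 2 * i"]] by (simp add: power2_eq_square algebra_simps)
  moreover have "\<not> p dvd 2 * i"
    using ndi nd2 assms(1) by (simp add: prime_dvd_mult_iff)
  ultimately have "Legendre (2 * i) p = 1"
    unfolding Legendre_eq_1_iff QuadRes_def by blast
  then have "Legendre 2 p * Legendre i p = 1"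
    using Legendre_mult assms p2 by simp
  then have eq: "Legendre 2 p = Legendre i p"
    using Legendre_cases[of 2 p] Legendre_cases[of i p] by auto
  have "nat ((p - 1) div 2) = 2 * nat k"
    using k p2 by simp
  then have "[Legendre i p = (i\<^sup>2) ^ nat k] (mod p)"
    using euler_criterion_int[OF assms(1) p2, of i] by (simp add: power_mult)
  also have "[(i\<^sup>2) ^ nat k = (-1) ^ nat k] (mod p)"
    by (rule cong_pow[OF i])
  finally have "Legendre i p = (-1) ^ nat k"
    using p2 Legendre_cases by (intro cong_imp_eq_signs) (auto simp: minus_one_power_iff)
  moreover have "p mod 8 = 1 \<longleftrightarrow> even k"
    using k by presburger
  moreover have "even (nat k) \<longleftrightarrow> even k"
    using k p2 by (simp add: even_nat_iff)
  ultimately show ?thesis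
    using eq by (simp add: minus_one_power_iff)
qed

text \<open>The sign in the reciprocity law is +1, since \<open>(p - 1) div 2\<close> is
  even.\<close>

lemma Legendre_reciprocity_1_mod_4:
  fixes p l :: int
  assumes "prime p" "[p = 1] (mod 4)" "prime l" "2 < l" "l \<noteq> p"
  shows "Legendre l p = Legendre p l"
proof -
  have p2: "2 < p" using prime_cong_1_mod_4_gt_2 assms by blast
  obtain k where "p = 4 * k + 1"
    using assms(2) by (metis cong_iff_dvd_diff dvd_def diff_eq_eq)
  then have "even (nat ((p - 1) div 2 * ((l - 1) div 2)))"
    using p2 assms by (simp add: even_nat_iff)
  with Quadratic_Reciprocity_int[of p l] have "Legendre p l * Legendre l p = 1"
    using p2 assms by simp
  then show ?thesis
    using Legendre_cases[of p l] Legendre_cases[of l p] by auto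
qed

section \<open>Quartic residues\<close>

text \<open>With \<open>i\<close> a square root of -1, both \<open>2 * i\<close> and
  \<open>-2 * i\<close> are squares, namely of \<open>1 + i\<close> and \<open>1 - i\<close>. Hence
  a fourth root of \<open>b\<close> yields a square root of \<open>s\<close>, and
  conversely.\<close>

lemma quartic_symbol_prime_eq_Legendre:
  fixes p b s :: int
  assumes p: "prime p" "[p = 1] (mod 4)" and bs: "[b * s\<^sup>2 = -4] (mod p)"
  shows "quartic_symbol_prime b p = Legendre s p"
proof -
  have p2: "2 < p" using prime_cong_1_mod_4_gt_2 p by blast
  obtain i where i: "[i\<^sup>2 = -1] (mod p)"
    using sqrt_minus_1_mod[OF p] .
  have nd2: "\<not> p dvd 2"
    using p2 by (auto dest: zdvd_imp_le)
  have nd4: "\<not> p dvd -4"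
    using nd2 p(1) prime_dvd_mult_iff[of p 2 2] by simp
  have "\<not> p dvd b * s\<^sup>2"
    using cong_dvd_iff[OF bs] nd4 by blast
  then have nds: "\<not> p dvd s"
    by (auto simp: power2_eq_square)
  have Lb: "Legendre b p = 1"
    using Legendre_cong_minus_4[OF p bs] .
  have plus: "[(1 + i)\<^sup>2 = 2 * i] (mod p)"
    using cong_add[OF i cong_refl[of "1 + 2 * i"]] by (simp add: power2_eq_square algebra_simps)
  have minus: "[(1 - i)\<^sup>2 = - (2 * i)] (mod p)"
    using cong_add[OF i cong_refl[of "1 - 2 * i"]] by (simp add: power2_eq_square algebra_simps)
  have i4: "[(2 * i)\<^sup>2 = -4] (mod p)"
    using cong_mult[OF cong_refl[of 4] i] by (simp add: power_mult_distrib)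
  have fourth: "[(1 + i) ^ 4 = -4] (mod p)"
    using cong_trans[OF cong_pow[OF plus, of 2] i4] by (simp flip: power_mult)
  have nd_2i: "\<not> p dvd 2 * i"
    using cong_dvd_iff[OF i4] nd4 by (metis dvd_mult2 power2_eq_square)
  have "(\<exists>x. [x ^ 4 = b] (mod p)) \<longleftrightarrow> QuadRes p s"
  proof
    assume "\<exists>x. [x ^ 4 = b] (mod p)"
    then obtain x where x: "[x ^ 4 = b] (mod p)" by blast
    \<comment> \<open>Both sides are congruent to -4, so \<open>s * x\<^sup>2\<close> is
      \<open>2 * i\<close> up to sign.\<close>
    have "[(s * x\<^sup>2)\<^sup>2 = (2 * i)\<^sup>2] (mod p)"
    proof -
      have "[x ^ 4 * s\<^sup>2 = -4] (mod p)"
        using cong_trans[OF cong_mult[OF x cong_refl] bs] .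
      then show ?thesis
        using cong_trans[OF _ cong_sym[OF i4]]
        by (simp add: power_mult_distrib mult.commute flip: power_mult)
    qed
    then have "p dvd (s * x\<^sup>2 - 2 * i) * (s * x\<^sup>2 + 2 * i)"
      by (simp add: cong_iff_dvd_diff power2_eq_square algebra_simps)
    then have "p dvd s * x\<^sup>2 - 2 * i \<or> p dvd s * x\<^sup>2 + 2 * i"
      using p(1) by (simp add: prime_dvd_mult_iff)
    then have "[s * x\<^sup>2 = 2 * i] (mod p) \<or> [s * x\<^sup>2 = - (2 * i)] (mod p)"
      by (simp add: cong_iff_dvd_diff)
    \<comment> \<open>The witness is \<open>1 + i\<close> or \<open>1 - i\<close>, according to the
      sign.\<close>
    then obtain y where y: "[s * x\<^sup>2 = y\<^sup>2] (mod p)" "\<not> p dvd y\<^sup>2"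
    proof
      assume "[s * x\<^sup>2 = 2 * i] (mod p)"
      with that[of "1 + i"] plus show ?thesis
        using nd_2i cong_dvd_iff[OF plus] cong_sym cong_trans by blast
    next
      assume "[s * x\<^sup>2 = - (2 * i)] (mod p)"
      with that[of "1 - i"] minus show ?thesis
        using nd_2i cong_dvd_iff[OF minus] cong_sym cong_trans dvd_minus_iff by metis
    qed
    have "\<not> p dvd y"
      using y(2) by (metis dvd_mult2 power2_eq_square)
    then have "Legendre s p = 1"
      using Legendre_cong_square[OF p(1) p2 _ y(1)] by blast
    then show "QuadRes p s" by (simp add: Legendre_eq_1_iff)
  next
    assume "QuadRes p s"
    then obtain t where t: "[t\<^sup>2 = s] (mod p)" by (auto simp: QuadRes_def)
    with nds have "\<not> p dvd t"
      using cong_dvd_iff[OF t] by (auto simp: power2_eq_square)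
    then have "coprime t p"
      using p(1) prime_imp_coprime coprime_commute by blast
    then obtain u where u: "[t * u = 1] (mod p)"
      using cong_solve_coprime_int by blast
    \<comment> \<open>The fourth root of \<open>b\<close> is \<open>(1 + i) / t\<close>, with
      \<open>u\<close> as the inverse of \<open>t\<close>: here -4 is \<open>b * s\<^sup>2\<close>,
      that is \<open>b * t ^ 4\<close>.\<close>
    have "[((1 + i) * u) ^ 4 = -4 * u ^ 4] (mod p)"
      using cong_mult[OF fourth cong_refl[of "u ^ 4"]] by (simp add: power_mult_distrib)
    also have "[-4 * u ^ 4 = (b * s\<^sup>2) * u ^ 4] (mod p)"
      by (rule cong_mult[OF cong_sym[OF bs] cong_refl])
    also have "[(b * s\<^sup>2) * u ^ 4 = (b * (t\<^sup>2)\<^sup>2) * u ^ 4] (mod p)"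
      by (intro cong_mult cong_refl cong_pow cong_sym[OF t])
    also have "(b * (t\<^sup>2)\<^sup>2) * u ^ 4 = b * (t * u) ^ 4"
      by (simp add: power_mult_distrib flip: power_mult)
    also have "[b * (t * u) ^ 4 = b * 1 ^ 4] (mod p)"
      by (intro cong_mult cong_refl cong_pow u)
    finally show "\<exists>x. [x ^ 4 = b] (mod p)" by auto
  qed
  with Lb nds show ?thesis
    by (simp add: quartic_symbol_prime_def Legendre_def cong_0_iff)
qed

section \<open>Products of Legendre symbols\<close>

lemma prod_prime_factors_squarefree:
  fixes a :: int
  assumes "squarefree a" "a > 0"
  shows "\<Prod>(prime_factors a) = a"
proof -
  have "a = (\<Prod>p\<in>prime_factors a. p ^ multiplicity p a)"
    using prod_prime_factors[of a] assms by simp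
  also have "\<dots> = \<Prod>(prime_factors a)"
    using assms squarefree_factorial_semiring'[of a] by (intro prod.cong) auto
  finally show ?thesis ..
qed

lemma prod_cong_1:
  fixes m :: int
  assumes "\<And>x. x \<in> A \<Longrightarrow> [f x = 1] (mod m)"
  shows "[(\<Prod>x\<in>A. f x) = 1] (mod m)"
  using cong_prod[of A f "\<lambda>_. 1" m] assms by simp

text \<open>The product is the Jacobi symbol of \<open>m\<close> over \<open>a\<close>. Induction on
  the prime divisors of \<open>m\<close>: reciprocity turns the factor of a prime \<open>l\<close>
  into \<open>Legendre a l\<close>, and the units are squares modulo every prime factor of
  \<open>a\<close>.\<close>

lemma prod_Legendre_odd:
  fixes a m :: int
  assumes a: "squarefree a" "a > 0" and p4: "\<And>p. p \<in> prime_factors a \<Longrightarrow> [p = 1] (mod 4)"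
    and m: "odd m" "\<And>l. prime l \<Longrightarrow> l dvd m \<Longrightarrow> Legendre a l = 1"
  shows "(\<Prod>p\<in>prime_factors a. Legendre m p) = 1"
  using m
proof (induction m rule: prime_divisors_induct)
  case zero
  then show ?case by simp
next
  case (unit x)
  then have "x = 1 \<or> x = -1" by auto
  then have "Legendre x p = 1" if "p \<in> prime_factors a" for p
    using that p4[OF that] Legendre_1 Legendre_minus_1 by auto
  then show ?case by simp
next
  case (factor l x)
  have "2 < l"
    using factor.prems(1) prime_ge_2_int[OF factor.hyps] by (cases "l = 2") auto
  have La: "Legendre a l = 1"
    using factor by simp
  have p2: "2 < p" "prime p" if "p \<in> prime_factors a" for p
    using that p4[OF that] prime_cong_1_mod_4_gt_2 by auto
  have "(\<Prod>p\<in>prime_factors a. Legendre l p) = (\<Prod>p\<in>prime_factors a. Legendre p l)"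
  proof (rule prod.cong[OF refl])
    fix p assume p: "p \<in> prime_factors a"
    \<comment> \<open>Otherwise \<open>l\<close> would divide \<open>a\<close>, making
      \<open>Legendre a l\<close> zero.\<close>
    have "l \<noteq> p"
      using p La by (auto simp: Legendre_eq_1_iff in_prime_factors_iff)
    then show "Legendre l p = Legendre p l"
      using p2[OF p] p4[OF p] \<open>2 < l\<close> factor.hyps by (intro Legendre_reciprocity_1_mod_4)
  qed
  also have "\<dots> = Legendre (\<Prod>(prime_factors a)) l"
    using Legendre_prod[OF factor.hyps \<open>2 < l\<close>, of "\<lambda>x. x"] by simp
  also have "\<dots> = 1"
    using a La by (simp add: prod_prime_factors_squarefree)
  finally have l1: "(\<Prod>p\<in>prime_factors a. Legendre l p) = 1" .
  have "(\<Prod>p\<in>prime_factors a. Legendre x p) = 1"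
    using factor by auto
  moreover have "(\<Prod>p\<in>prime_factors a. Legendre (l * x) p) =
      (\<Prod>p\<in>prime_factors a. Legendre l p * Legendre x p)"
    using p2 by (intro prod.cong refl Legendre_mult)
  ultimately show ?case
    using l1 by (simp add: prod.distrib)
qed

text \<open>A prime that is 5 modulo 8 has symbol -1 and swaps the two cases, because 5 * 5 is 1
  modulo 8; a prime that is 1 modulo 8 changes neither.\<close>

lemma prod_Legendre_2:
  fixes A :: "int set"
  assumes "finite A" "\<And>p. p \<in> A \<Longrightarrow> prime p \<and> [p = 1] (mod 4)"
  shows "\<Prod>A mod 8 = 1 \<and> (\<Prod>p\<in>A. Legendre 2 p) = 1 \<or>
         \<Prod>A mod 8 = 5 \<and> (\<Prod>p\<in>A. Legendre 2 p) = -1"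
  using assms
proof (induction A rule: finite_induct)
  case empty
  then show ?case by simp
next
  case (insert p A)
  have p: "prime p" "[p = 1] (mod 4)"
    using insert.prems by auto
  then have "p mod 4 = 1" by (simp add: cong_def)
  then have "p mod 8 = 1 \<or> p mod 8 = 5" by presburger
  moreover have "(p * \<Prod>A) mod 8 = ((p mod 8) * (\<Prod>A mod 8)) mod 8"
    by (simp add: mod_mult_eq)
  ultimately show ?case
    using insert Legendre_2[OF p] by auto
qed

section \<open>The power of 2 dividing \<open>s\<close>\<close>

text \<open>An odd exponent \<open>j\<close> is 1 or at least 3. After division by 4, the first case
  is impossible modulo 4, and the second forces \<open>a\<close> to be 1 modulo 8.\<close>

lemma even_exponent_or_cong_1_mod_8:
  fixes a b r m :: int
  assumes eq: "a * r\<^sup>2 - b * (2 ^ j * m)\<^sup>2 = 4"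
    and m: "odd m" and a: "[a = 1] (mod 4)" and b: "[b = 1] (mod 4)"
  shows "even j \<or> a mod 8 = 1"
proof (rule ccontr)
  assume "\<not> (even j \<or> a mod 8 = 1)"
  then have j: "odd j" and a8: "a mod 8 \<noteq> 1" by auto
  from j have "j = 1 \<or> j \<ge> 3" by presburger
  have "odd a" using a by (auto simp: cong_def) presburger
  obtain j' where j': "j = Suc j'" using j by (cases j) auto
  have "even (a * r\<^sup>2)"
  proof -
    have "a * r\<^sup>2 = 4 + b * (2 ^ j * m)\<^sup>2" using eq by simp
    then show ?thesis by (simp add: j')
  qed
  with \<open>odd a\<close> obtain R where R: "r = 2 * R" by auto
  have eq': "a * R\<^sup>2 = 1 + b * (2 ^ j' * m)\<^sup>2"
    using eq by (simp add: R j' power_mult_distrib)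
  show False
    using \<open>j = 1 \<or> j \<ge> 3\<close>
  proof
    assume "j = 1"
    then have eq'': "a * R\<^sup>2 = 1 + b * m\<^sup>2" using eq' j' by simp
    have "[m\<^sup>2 = 1] (mod 4)"
    proof -
      obtain k where "m = 2 * k + 1" using m oddE by blast
      then have "m\<^sup>2 = 1 + 4 * (k * k + k)" by (simp add: power2_eq_square algebra_simps)
      then show ?thesis by (simp only: cong_def mod_mult_self2)
    qed
    \<comment> \<open>This makes \<open>R\<^sup>2\<close> congruent to 2 modulo 4, which no square
      is.\<close>
    have "[1 + b * m\<^sup>2 = 1 + 1 * 1] (mod 4)"
      by (intro cong_add cong_mult b cong_refl) fact
    moreover have "[a * R\<^sup>2 = 1 * R\<^sup>2] (mod 4)"
      by (intro cong_mult a cong_refl)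
    ultimately have "R\<^sup>2 mod 4 = 2"
      using eq'' by (simp add: cong_def)
    moreover have "even R \<Longrightarrow> R\<^sup>2 mod 4 = 0" by (auto simp: power2_eq_square)
    moreover have "even (z::int)" if "z mod 4 = 2" for z
      using that by presburger
    ultimately show False by (metis even_power zero_neq_numeral)
  next
    assume "j \<ge> 3"
    then have "2 \<le> j'" using j' by simp
    then obtain i where i: "j' = i + 2"
      by (metis add.commute le_Suc_ex)
    have eq'': "a * R\<^sup>2 = 1 + 16 * (b * (2 ^ i * m)\<^sup>2)"
      using eq' by (simp add: i power_mult_distrib power_add)
    then have "odd (a * R\<^sup>2)" by simp
    then obtain k where k: "R = 2 * k + 1" using oddE by auto
    obtain c where c: "k * k + k = 2 * c"
    proof -
      have "even (k * k + k)" by simp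
      then show ?thesis using that by blast
    qed
    have "R\<^sup>2 = 1 + 4 * (k * k + k)"
      by (simp add: k power2_eq_square algebra_simps)
    then have "R\<^sup>2 = 1 + 8 * c" using c by simp
    \<comment> \<open>Odd squares are 1 modulo 8: substituting \<open>1 + 8 * c\<close> for
      \<open>R\<^sup>2\<close> and solving for the linear term \<open>a\<close> gives this
      form.\<close>
    then have "a = 1 + 8 * (2 * (b * (2 ^ i * m)\<^sup>2) - a * c)"
      using eq'' by (simp add: algebra_simps)
    then have "a mod 8 = 1"
      by presburger
    with a8 show False ..
  qed
qed

section \<open>Application to solutions of \<open>a * r\<^sup>2 - b * s\<^sup>2 = 4\<close>\<close>

theorem theorem6p7:
  fixes n :: nat and p :: "nat \<Rightarrow> int" and \<Delta> a b :: int
  assumes "\<And>i. i \<in> {1..n} \<Longrightarrow> prime (p i)"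
    and "\<And>i. i \<in> {1..n} \<Longrightarrow> [p i = 1] (mod 4)"
    and "inj_on p {1..n}"
    and "\<Delta> = (\<Prod>i=1..n. p i)"
    and "a > 0" and "b > 0" and "a * b = \<Delta>"
    and "\<exists>r s :: int. a * r\<^sup>2 - b * s\<^sup>2 = 4"
  shows "(\<forall>q. prime q \<and> q dvd b \<longrightarrow> Legendre a q = 1) \<and>
         (\<forall>q. prime q \<and> q dvd a \<longrightarrow> Legendre b q = 1) \<and>
         quartic_symbol b a = 1"
proof -
  from assms(8) obtain r s where rs: "a * r\<^sup>2 - b * s\<^sup>2 = 4" by blast
  have q4: "[q = 1] (mod 4)" if "prime q" "q dvd \<Delta>" for q
  proof -
    from that obtain i where i: "i \<in> {1..n}" "q dvd p i"
      using assms(4) by (auto simp: prime_dvd_prod_iff)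
    then have "q = p i" using that(1) assms(1) primes_dvd_imp_eq by blast
    with i assms(2) show ?thesis by simp
  qed
  have "squarefree \<Delta>"
    unfolding assms(4)
  proof (rule squarefree_prod_coprime)
    fix i j assume "i \<in> {1..n}" "j \<in> {1..n}" "i \<noteq> j"
    then show "coprime (p i) (p j)"
      using assms(1,3) by (intro primes_coprime) (auto dest: inj_onD)
  qed (use assms(1) squarefree_prime in blast)
  then have sqf: "squarefree a" "squarefree b"
    using squarefree_multD assms(7) by blast+
  have a4: "[q = 1] (mod 4)" if "prime q" "q dvd a" for q
    using that q4 assms(7) by (metis dvd_mult2)
  have b4: "[q = 1] (mod 4)" if "prime q" "q dvd b" for q
    using that q4 assms(7) by (metis dvd_mult)
  have nd2: "\<not> q dvd 2" if "2 < q" for q :: int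
    using that by (auto dest: zdvd_imp_le)
  \<comment> \<open>Allowing divisors of \<open>b * s\<^sup>2\<close> serves two purposes: the
    primes dividing \<open>b\<close> give the first claim, and the odd primes dividing
    \<open>s\<close> are needed for the third.\<close>
  have part1: "Legendre a q = 1" if "prime q" "2 < q" "q dvd b * s\<^sup>2" for q
  proof (rule Legendre_cong_square[OF that(1,2) nd2[OF that(2)]])
    have "a * r\<^sup>2 - 2\<^sup>2 = b * s\<^sup>2" using rs by simp
    then show "[a * r\<^sup>2 = 2\<^sup>2] (mod q)"
      using that(3) by (simp add: cong_iff_dvd_diff)
  qed
  have bs: "[b * s\<^sup>2 = -4] (mod q)" if "q dvd a" for q
  proof -
    have "b * s\<^sup>2 - (-4) = a * r\<^sup>2" using rs by simp
    then show ?thesis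
      using that by (metis cong_iff_dvd_diff dvd_mult2)
  qed
  have part2: "Legendre b q = 1" if "prime q" "q dvd a" for q
    using Legendre_cong_minus_4 a4 bs that by blast
  have acong: "[a = 1] (mod 4)" and bcong: "[b = 1] (mod 4)"
    using prod_cong_1[of "prime_factors a" "\<lambda>x. x" 4] prod_cong_1[of "prime_factors b" "\<lambda>x. x" 4]
      a4 b4 sqf assms(5,6) by (auto simp: prod_prime_factors_squarefree in_prime_factors_iff)
  have quartic: "quartic_symbol b a = (\<Prod>q\<in>prime_factors a. Legendre s q)"
    unfolding quartic_symbol_def
    by (intro prod.cong refl quartic_symbol_prime_eq_Legendre a4 bs) auto
  have "(\<Prod>q\<in>prime_factors a. Legendre s q) = 1"
  proof (cases "s = 0")
    case True
    \<comment> \<open>For \<open>s = 0\<close>, a prime factor of \<open>a\<close> would divide 4,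
      yet all of them exceed 2; the product is then empty.\<close>
    then have "prime_factors a = {}"
    proof (intro equals0I)
      fix q assume "q \<in> prime_factors a"
      then have q: "prime q" "q dvd a" by auto
      then have "q dvd 2 * 2" using bs[OF q(2)] True by (simp add: cong_iff_dvd_diff)
      then have "q dvd 2" using q(1) by (metis prime_dvd_mult_iff)
      with nd2 prime_cong_1_mod_4_gt_2[OF q(1) a4[OF q]] show False by blast
    qed
    then show ?thesis by simp
  next
    case False
    define j where "j = multiplicity 2 s"
    obtain m where m: "s = 2 ^ j * m" "odd m"
      using multiplicity_decompose'[of s 2] False unfolding j_def by auto
    have pf: "prime q" "2 < q" if "q \<in> prime_factors a" for q
      using that a4 prime_cong_1_mod_4_gt_2 by auto
    have 1: "(\<Prod>q\<in>prime_factors a. Legendre m q) = 1"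
    proof (rule prod_Legendre_odd[OF sqf(1) assms(5)])
      fix l assume l: "prime l" "l dvd m"
      then have "l \<noteq> 2" using m(2) by auto
      then have "2 < l" using prime_ge_2_int[OF l(1)] by simp
      then show "Legendre a l = 1"
        using part1[of l] l m(1) by (simp add: power2_eq_square)
    qed (use a4 m in auto)
    \<comment> \<open>The base is 1 or -1, so an even \<open>j\<close> suffices; otherwise
      \<open>a\<close> is 1 modulo 8 and the base is 1.\<close>
    have 2: "(\<Prod>q\<in>prime_factors a. Legendre 2 q) ^ j = 1"
    proof -
      have "even j \<or> a mod 8 = 1"
        using even_exponent_or_cong_1_mod_8 rs m acong bcong by blast
      moreover have "a mod 8 = 1 \<and> (\<Prod>q\<in>prime_factors a. Legendre 2 q) = 1 \<or>
          a mod 8 = 5 \<and> (\<Prod>q\<in>prime_factors a. Legendre 2 q) = -1"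
        using prod_Legendre_2[of "prime_factors a"] a4 sqf(1) assms(5)
        by (auto simp: prod_prime_factors_squarefree)
      ultimately show ?thesis by auto
    qed
    have "(\<Prod>q\<in>prime_factors a. Legendre s q) =
        (\<Prod>q\<in>prime_factors a. Legendre 2 q ^ j * Legendre m q)"
      using pf by (intro prod.cong refl) (simp add: m(1) Legendre_mult Legendre_power)
    with 1 2 show ?thesis
      by (simp add: prod.distrib prod_power_distrib)
  qed
  with quartic part2 show ?thesis
    using part1 b4 prime_cong_1_mod_4_gt_2 by auto
qed

end
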